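(* Let $G$ be a finitely generated group with an exact tessellation $\mathcal{T}_G=\{D_i\}_{i\in I}$ of its action on a connected cone $P$, let $H<G$ be a subgroup of finite index, fix $i_0\in I$ and let $K=G_{i_0}$ be the stabilizer of $D_{i_0}$ in $G$. Let $J=\{j_1,\dots,j_m\}\subset I$ be an $H$-fundamental subset with $m=|J|=|H\backslash G/K|$. For $1\le t\le m$ let $H_{j_t}:=G_{j_t}\cap H$, where $G_{j_t}=\{g\in G: g(D_{j_t})=D_{j_t}\}$; the group $H_{j_t}$ acts on the finite set of codimension one faces of $D_{j_t}$, and we denote by $a_t$ the number of orbits of this action. Then $$l(H)\le\sum_{t=1}^m\bigl(l(H_{j_t})+a_t\bigr)+l(K\cap H)-|\mathcal{N}_J|.$$ In particular, $$l(H)\le\sum_{t=1}^m\bigl(l(H_{j_t})+a_t\bigr)+l(K\cap H).$$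
   Context: For a finitely generated group $\Gamma$, $l(\Gamma)$ denotes the minimal number of generators of $\Gamma$, with $l(\{1\})=0$. Setting: $G$ is a finitely generated group and $H<G$ a subgroup with $[G:H]<\infty$. $G$ acts faithfully on a connected cone $P\subset\mathbb{R}^\rho$ ($\rho\ge2$) with vertex at the origin $0$ (possibly $0\notin P$), and there is an exact tessellation $\mathcal{T}_G=\{D_i\}_{i\in I}$ of this action: each $D_i\subset P$ is of dimension $\rho$ and is a cone over a closed finite polyhedron in $P$ with vertex $0$; $G$ acts transitively on the set $\mathcal{T}_G$ by $(g,D_i)\mapsto g(D_i)$; and for each $i\in I$: (1) $P=\bigcup_{g\in G}g(D_i)$; (2) $G_i:=\{g\in G: g(D_i)=D_i\}$ is finite (not necessarily trivial); (3) for $i'\ne i$, $D_i\cap D_{i'}$ is either empty or exactly one face of codimension $\ge1$, possibly $\{0\}$, of both $D_i$ and $D_{i'}$; (4) for each codimension one face $\Delta$ of $D_i$ there is a unique $i'\in I$ with $D_i\cap D_{i'}=\Delta$. A subset $J\subset I$ is called $H$-fundamental if (1a) $P=\bigcup_{g\in H,\,j\in J}g(D_j)$; and (2a) if $j,j'\in J$ and $j\ne j'$, then $g(D_j)\ne D_{j'}$ for every $g\in H$. For $i\ne i'$, $D_{i'}$ is adjacent to $D_i$ if $D_i\cap D_{i'}$ is a codimension one face of both. Put $\mathcal{N}_J=\{(j,j')\in J\times J: D_j\text{ is adjacent to }D_{j'}\}$.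
   Formalization: The interior of P is also assumed connected (automatic for convex or open connected P): for P={xy>0}∪{0} in R² and G=D∞×{±1} the stated bound fails, 3≤2. G is taken to act by homeomorphisms of P, and each D_i is a cone over a convex polytope. *)

theory Defs
  imports
    "HOL-Analysis.Analysis"
    "HOL-Algebra.Generated_Groups"
    "HOL-Algebra.Group_Action"
begin

definition finitely_generated :: "('g, 'b) monoid_scheme \<Rightarrow> bool" where
  "finitely_generated G \<longleftrightarrow> (\<exists>S. finite S \<and> S \<subseteq> carrier G \<and> generate G S = carrier G)"

(* Meaningful only for finitely generated groups; the value at other groups is arbitrary.
   The empty set generates the trivial group, which therefore has value 0. *)
definition min_generators :: "('g, 'b) monoid_scheme \<Rightarrow> nat" where
  "min_generators G =
     (LEAST n. \<exists>S. finite S \<and> S \<subseteq> carrier G \<and> card S = n \<and> generate G S = carrier G)"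

definition double_cosets :: "('g, 'b) monoid_scheme \<Rightarrow> 'g set \<Rightarrow> 'g set \<Rightarrow> 'g set set" where
  "double_cosets G H K = {(H #>\<^bsub>G\<^esub> g) <#>\<^bsub>G\<^esub> K | g. g \<in> carrier G}"

definition setwise :: "('g \<Rightarrow> 'v \<Rightarrow> 'v) \<Rightarrow> 'g \<Rightarrow> 'v set \<Rightarrow> 'v set" where
  "setwise \<phi> g X = \<phi> g ` X"

(* The vertex 0 need not belong to the cone, hence only strictly positive factors. *)
definition cone_at_origin :: "'v::real_vector set \<Rightarrow> bool" where
  "cone_at_origin P \<longleftrightarrow> (\<forall>x\<in>P. \<forall>c>0. c *\<^sub>R x \<in> P)"

(* The intersection with P only serves to drop the vertex 0 if it is not in P. *)
definition polyhedral_cone_in :: "(real ^ 'n) set \<Rightarrow> (real ^ 'n) set \<Rightarrow> bool" where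
  "polyhedral_cone_in P D \<longleftrightarrow> (\<exists>Q. polytope Q \<and> Q \<subseteq> P \<and> D = (cone hull Q) \<inter> P)"

(* The action is by homeomorphisms of P, not necessarily linear ones. Continuity of the
   inverses is continuity of the action of the inverse elements.
   Connectedness of P alone does not make adjacency of chambers connected, as P may be pinched
   along a ray: let an infinite dihedral group of plane reflections tessellate {x > 0, y < 0}
   and take P = {xy < 0} together with the two open half-lines of the z-axis in R^3. The theorem
   fails there for the group generated by the reflections, z -> -z and -1, so it assumes in
   addition that the interior of P is connected, which is automatic if P is convex, or
   connected and open. *)
locale exact_tessellation = faithful_action G P \<phi>
  for G (structure) and P :: "(real ^ 'n) set" and \<phi> +
  fixes I :: "'i set" and D :: "'i \<Rightarrow> (real ^ 'n) set"
  assumes dim_ge_2: "CARD('n) \<ge> 2"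
    and connected_P: "connected P"
    and cone_P: "cone_at_origin P"
    and continuous_action: "\<And>g. g \<in> carrier G \<Longrightarrow> continuous_on P (\<phi> g)"
    and polyhedral_cone_D: "\<And>i. i \<in> I \<Longrightarrow> polyhedral_cone_in P (D i)"
    and full_dim_D: "\<And>i. i \<in> I \<Longrightarrow> aff_dim (D i) = int CARD('n)"
    (* the restriction puts the action on sets into the extensional form of BijGroup *)
    and transitive: "transitive_action G (D ` I) (\<lambda>g. restrict (setwise \<phi> g) (D ` I))"
    and covers: "\<And>i. i \<in> I \<Longrightarrow> P = (\<Union>g\<in>carrier G. \<phi> g ` D i)"
    and finite_stabilizer: "\<And>i. i \<in> I \<Longrightarrow> finite (stabilizer G (setwise \<phi>) (D i))"
    and face_to_face: "\<And>i i'. \<lbrakk>i \<in> I; i' \<in> I; i \<noteq> i'\<rbrakk> \<Longrightarrow>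
      D i \<inter> D i' = {} \<or>
      (D i \<inter> D i' face_of D i \<and> D i \<inter> D i' face_of D i' \<and>
       aff_dim (D i \<inter> D i') \<le> int CARD('n) - 1)"
    and unique_neighbour: "\<And>i F. \<lbrakk>i \<in> I; F facet_of D i\<rbrakk> \<Longrightarrow> \<exists>!i'. i' \<in> I \<and> D i \<inter> D i' = F"

definition fundamental ::
    "'g set \<Rightarrow> 'v set \<Rightarrow> ('g \<Rightarrow> 'v \<Rightarrow> 'v) \<Rightarrow> 'i set \<Rightarrow> ('i \<Rightarrow> 'v set) \<Rightarrow> 'i set \<Rightarrow> bool" where
  "fundamental H P \<phi> I D J \<longleftrightarrow>
     J \<subseteq> I \<and>
     P = (\<Union>g\<in>H. \<Union>j\<in>J. \<phi> g ` D j) \<and>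
     (\<forall>j\<in>J. \<forall>j'\<in>J. j \<noteq> j' \<longrightarrow> (\<forall>g\<in>H. \<phi> g ` D j \<noteq> D j'))"

definition adjacent :: "('i \<Rightarrow> 'v::euclidean_space set) \<Rightarrow> 'i \<Rightarrow> 'i \<Rightarrow> bool" where
  "adjacent D i i' \<longleftrightarrow> i \<noteq> i' \<and> D i \<inter> D i' facet_of D i \<and> D i \<inter> D i' facet_of D i'"

definition adjacent_pairs :: "('i \<Rightarrow> 'v::euclidean_space set) \<Rightarrow> 'i set \<Rightarrow> ('i \<times> 'i) set" where
  "adjacent_pairs D J = {(j, j') \<in> J \<times> J. adjacent D j j'}"

definition facet_orbit_count ::
    "('g, 'b) monoid_scheme \<Rightarrow> ('g \<Rightarrow> 'v \<Rightarrow> 'v) \<Rightarrow> 'g set \<Rightarrow> 'v::euclidean_space set \<Rightarrow> nat" where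
  "facet_orbit_count G \<phi> S X =
     card (orbits (G\<lparr>carrier := S\<rparr>) {F. F facet_of X} (setwise \<phi>))"

end

theory Submission
  imports Defs
begin

text \<open>Call two chambers equivalent if they are joined by a gallery, a sequence of chambers in which
  consecutive ones are adjacent. No local finiteness is needed to see that all chambers are
  equivalent: there are only countably many, since their interiors are disjoint, so a generic
  segment in a ball inside the interior of \<open>P\<close> avoids all faces of codimension at least two, and
  near every point of such a segment \<open>P\<close> is covered by one chamber or by two adjacent ones. As the
  interior of \<open>P\<close> is connected, the equivalence classes cannot be separated.

  Each orbit of \<open>H\<^sub>j\<close> on the facets of \<open>D j\<close> yields an element \<open>h \<in> H\<close> such that the neighbour
  across a facet in that orbit is \<open>h (D j')\<close> with \<open>j' \<in> J\<close>. Following galleries, these elements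
  and the groups \<open>H\<^sub>j\<close> generate \<open>H\<close>. A pair in \<open>adjacent_pairs D J\<close> permits the choice \<open>h = 1\<close>, and
  distinct pairs belong to distinct facet orbits, so that many generators can be dropped.\<close>

section \<open>Convex sets meeting in a common facet\<close>

text \<open>Turns dimension bounds into measure zero, so that countably many thin sets can be
  avoided at once.\<close>

lemma negligible_aff_dim_less:
  fixes S :: "'a::euclidean_space set"
  assumes "aff_dim S < int DIM('a)"
  shows "negligible S"
proof -
  have "interior (affine hull S) = {}"
    using assms aff_dim_nonempty_interior[of "affine hull S"] by force
  then have "negligible (affine hull S)"
    by (simp add: negligible_convex_interior affine_imp_convex)
  then show ?thesis
    using negligible_subset[OF _ hull_subset] by blast
qed

lemma open_not_subset_negligible:
  fixes U :: "'a::euclidean_space set"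
  assumes "open U" "U \<noteq> {}" "negligible N"
  shows "\<not> U \<subseteq> N"
  using assms open_not_negligible[of U] negligible_subset[of N U] by blast

text \<open>First choose \<open>x\<close> outside the null set \<open>\<Union>W\<close>. Joining
  \<open>x\<close> to a set of codimension two spans an affine space of codimension at least one, so
  \<open>y\<close> can be chosen outside all of these. A segment that hits some \<open>E\<close>
  would put \<open>y\<close> on a line through \<open>x\<close> and a point of
  \<open>E\<close>.\<close>

lemma generic_segment:
  fixes U V :: "'a::euclidean_space set"
  assumes U: "open U" "U \<noteq> {}" and V: "open V" "V \<noteq> {}"
    and W: "countable W" "\<And>E. E \<in> W \<Longrightarrow> aff_dim E \<le> int DIM('a) - 2"
  obtains x y where "x \<in> U" "y \<in> V" "closed_segment x y \<inter> \<Union>W = {}"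
proof -
  have "negligible (\<Union>W)"
  proof (intro negligible_countable_Union negligible_aff_dim_less)
    fix E assume "E \<in> W"
    then show "aff_dim E < int DIM('a)" using W(2) by fastforce
  qed (use W in simp)
  then obtain x where x: "x \<in> U" "x \<notin> \<Union>W"
    using open_not_subset_negligible[OF U] by blast
  have "negligible (\<Union>E\<in>W. affine hull insert x E)"
  proof (intro negligible_countable_Union negligible_aff_dim_less)
    fix E assume "E \<in> (\<lambda>E. affine hull insert x E) ` W"
    then show "aff_dim E < int DIM('a)"
      using W(2) by (force simp: aff_dim_insert)
  qed (use W in auto)
  then obtain y where y: "y \<in> V" "y \<notin> (\<Union>E\<in>W. affine hull insert x E)"
    using open_not_subset_negligible[OF V] by blast
  have False if z: "z \<in> closed_segment x y" "z \<in> E" "E \<in> W" for z E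
  proof -
    obtain u where u: "z = (1 - u) *\<^sub>R x + u *\<^sub>R y"
      using z(1) by (auto simp: in_segment)
    \<comment> \<open>Otherwise \<open>z = x\<close>, which lies in no member of \<open>W\<close>.
      Hence \<open>y\<close> can be solved for on the line through \<open>x\<close> and
      \<open>z\<close>.\<close>
    have "u \<noteq> 0" using u z x by auto
    then have "y = (1 - 1/u) *\<^sub>R x + (1/u) *\<^sub>R z"
      by (simp add: u algebra_simps flip: scaleR_add_left)
    moreover have "x \<in> affine hull insert x E" "z \<in> affine hull insert x E"
      using z(2) by (auto intro: hull_inc)
    ultimately have "y \<in> affine hull insert x E"
      using mem_affine[OF affine_affine_hull, of x "insert x E" z "1 - 1/u" "1/u"] by simp
    then show False using y(2) z(3) by blast
  qed
  with x y that show thesis by blast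
qed

text \<open>A point near \<open>x\<close> on the side of \<open>p\<close> is a convex combination of \<open>p\<close> and a point of \<open>F\<close> near \<open>x\<close>.\<close>

lemma half_ball_subset_convex:
  fixes D :: "'a::euclidean_space set"
  assumes D: "convex D" and F: "F \<subseteq> D" "affine hull F = {y. a \<bullet> y = b}"
    and x: "x \<in> rel_interior F" and p: "p \<in> D" "a \<bullet> p < b"
  obtains e where "e > 0" "ball x e \<inter> {y. a \<bullet> y \<le> b} \<subseteq> D"
proof -
  obtain d where d: "d > 0" "ball x d \<inter> affine hull F \<subseteq> F" and "x \<in> F"
    using x by (auto simp: mem_rel_interior_ball)
  have ax: "a \<bullet> x = b"
    using \<open>x \<in> F\<close> F(2) hull_inc by fastforce
  \<comment> \<open>The weight \<open>t y\<close> is the one for which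
    \<open>y = (1 - t y) f y + t y p\<close> has \<open>f y\<close> on the hyperplane. At
    \<open>x\<close> it vanishes and \<open>f x = x\<close>, so continuity keeps \<open>f y\<close>
    in \<open>F\<close> for \<open>y\<close> near \<open>x\<close>.\<close>
  define t where "t y = (b - a \<bullet> y) / (b - a \<bullet> p)" for y
  define f where "f y = (1 / (1 - t y)) *\<^sub>R (y - t y *\<^sub>R p)" for y
  have tx: "t x = 0" by (simp add: t_def ax)
  have cont_t: "isCont t x"
    unfolding t_def by (intro continuous_intros) (use p in auto)
  have "isCont f x"
    unfolding f_def by (intro continuous_intros cont_t) (simp add: tx)
  then have "(f \<longlongrightarrow> x) (nhds x)"
    by (metis tendsto_at_iff_tendsto_nhds isCont_def f_def tx diff_zero div_by_1 scale_zero_left scaleR_one)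
  then have 1: "\<forall>\<^sub>F y in nhds x. f y \<in> ball x d"
    by (rule topological_tendstoD) (use d in auto)
  have "(t \<longlongrightarrow> 0) (nhds x)"
    using cont_t by (metis tendsto_at_iff_tendsto_nhds isCont_def tx)
  then have 2: "\<forall>\<^sub>F y in nhds x. t y < 1"
    by (rule order_tendstoD) simp
  obtain e where e: "e > 0" "\<And>y. dist y x < e \<Longrightarrow> f y \<in> ball x d \<and> t y < 1"
    using eventually_conj[OF 1 2] unfolding eventually_nhds_metric by blast
  have "y \<in> D" if "y \<in> ball x e" "a \<bullet> y \<le> b" for y
  proof -
    have y: "f y \<in> ball x d" "t y < 1" "t y \<ge> 0"
      using e(2)[of y] that p by (auto simp: dist_commute t_def)
    have "a \<bullet> y - t y * (a \<bullet> p) = (1 - t y) * b"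
      using p by (simp add: t_def field_simps)
    then have "a \<bullet> f y = b"
      using y by (simp add: f_def inner_diff_right)
    then have "f y \<in> D" using y d F by auto
    then have "(1 - t y) *\<^sub>R f y + t y *\<^sub>R p \<in> D"
      using D p y by (simp add: convexD_alt)
    moreover have "(1 - t y) *\<^sub>R f y + t y *\<^sub>R p = y"
      using y by (simp add: f_def)
    ultimately show ?thesis by simp
  qed
  then show thesis using that e(1) by blast
qed

lemma full_dim_not_in_hyperplane:
  fixes D :: "'a::euclidean_space set"
  assumes "aff_dim D = int DIM('a)" "a \<noteq> 0"
  obtains p where "p \<in> D" "a \<bullet> p \<noteq> b"
proof -
  have "\<not> D \<subseteq> {y. a \<bullet> y = b}"
    using assms aff_dim_subset[of D "{y. a \<bullet> y = b}"] by auto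
  then show thesis using that by blast
qed

text \<open>Each set contains a half ball around \<open>x\<close> on one side of the hyperplane
  spanned by the common part. The sides are opposite, since otherwise the intersection would contain
  a nonempty open set; the two half balls then make up a ball.\<close>

lemma interior_Un_of_common_facet:
  fixes D D' :: "'a::euclidean_space set"
  assumes D: "convex D" "aff_dim D = int DIM('a)" and D': "convex D'" "aff_dim D' = int DIM('a)"
    and dim: "aff_dim (D \<inter> D') = int DIM('a) - 1" and x: "x \<in> rel_interior (D \<inter> D')"
  shows "x \<in> interior (D \<union> D')"
proof -
  obtain a b where ab: "a \<noteq> 0" "affine hull (D \<inter> D') = {y. a \<bullet> y = b}"
    using dim aff_dim_eq_hyperplane[of "D \<inter> D'"] by (auto simp: of_nat_diff Suc_le_eq)
  \<comment> \<open>Normalised so that \<open>D\<close> has a point on the side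
    \<open>a \<bullet> y < b\<close>; the other case follows by changing the signs of
    \<open>a\<close> and \<open>b\<close>.\<close>
  have main: "x \<in> interior (D \<union> D')"
    if C: "convex D" "convex D'" and x: "x \<in> rel_interior (D \<inter> D')"
      and dim: "aff_dim (D \<inter> D') = int DIM('a) - 1"
      and ab: "a \<noteq> 0" "affine hull (D \<inter> D') = {y. a \<bullet> y = b}"
      and p: "p \<in> D" "a \<bullet> p < b" and q: "q \<in> D'" "a \<bullet> q \<noteq> b"
    for D D' :: "'a set" and a b p q
  proof -
    have xb: "a \<bullet> x = b"
      using subsetD[OF rel_interior_subset x] hull_inc[of x "D \<inter> D'" affine] ab(2) by blast
    obtain e where e: "e > 0" "ball x e \<inter> {y. a \<bullet> y \<le> b} \<subseteq> D"
      using half_ball_subset_convex[OF C(1) _ ab(2) x p] by auto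
    have "\<not> a \<bullet> q < b"
    proof
      assume "a \<bullet> q < b"
      then obtain e' where e': "e' > 0" "ball x e' \<inter> {y. a \<bullet> y \<le> b} \<subseteq> D'"
        using half_ball_subset_convex[OF C(2) _ ab(2) x q(1)] by auto
      let ?U = "ball x (min e e') \<inter> {y. a \<bullet> y < b}"
      have "?U \<subseteq> D \<inter> D'" using e e' by auto
      moreover have "negligible (D \<inter> D')"
        by (rule negligible_aff_dim_less) (simp add: dim)
      moreover have "open ?U" by (simp add: open_Int open_halfspace_lt)
      ultimately have "?U = {}"
        using open_not_subset_negligible[of ?U "D \<inter> D'"] by blast
      \<comment> \<open>Moving from \<open>x\<close> by \<open>- s a\<close> covers half the radius
        and enters the open half space, so \<open>?U\<close> is not empty.\<close>
      moreover define s where "s = min e e' / (2 * norm a)"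
      have s: "s > 0" using e e' ab by (simp add: s_def)
      have "x - s *\<^sub>R a \<in> ?U"
        using s ab e e' xb by (auto simp: dist_norm inner_diff_right s_def)
      ultimately show False by blast
    qed
    then have "(- a) \<bullet> q < - b" using q by simp
    moreover have "affine hull (D \<inter> D') = {y. (- a) \<bullet> y = - b}" using ab by auto
    ultimately obtain e' where e': "e' > 0" "ball x e' \<inter> {y. (-a) \<bullet> y \<le> -b} \<subseteq> D'"
      using half_ball_subset_convex[OF C(2) _ _ x q(1)] by (metis inf_le2)
    have "ball x (min e e') \<subseteq> D \<union> D'"
    proof
      fix y assume "y \<in> ball x (min e e')"
      then show "y \<in> D \<union> D'" using e e' by (cases "a \<bullet> y \<le> b") auto
    qed
    then show ?thesis using e e' by (meson mem_interior min_less_iff_conj)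
  qed
  obtain p where p: "p \<in> D" "a \<bullet> p \<noteq> b"
    using full_dim_not_in_hyperplane D(2) ab(1) .
  obtain q where q: "q \<in> D'" "a \<bullet> q \<noteq> b"
    using full_dim_not_in_hyperplane D'(2) ab(1) .
  show ?thesis
  proof (cases "a \<bullet> p < b")
    case True
    then show ?thesis using main D D' x dim ab p q by blast
  next
    case False
    have "affine hull (D \<inter> D') = {y. (- a) \<bullet> y = - b}" using ab by auto
    then show ?thesis
      using main[OF D(1) D'(1) x dim, of "-a" "-b" p q] False p q ab by auto
  qed
qed

section \<open>Polyhedral cones\<close>

text \<open>The point \<open>x\<close> lies strictly between \<open>c x\<close> and another positive
  multiple \<open>d x\<close>, both in \<open>D\<close>, so a face containing \<open>x\<close>
  contains both.\<close>

lemma face_of_cone_at_origin: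
  assumes "cone_at_origin D" "F face_of D"
  shows "cone_at_origin F"
  unfolding cone_at_origin_def
proof (intro ballI allI impI)
  fix x and c :: real assume x: "x \<in> F" and c: "c > 0"
  show "c *\<^sub>R x \<in> F"
  proof (cases "x = 0 \<or> c = 1")
    case False
    \<comment> \<open>Any positive \<open>d\<close> with 1 strictly between \<open>c\<close> and
      \<open>d\<close> would do; \<open>u\<close> solves \<open>(1 - u) c + u d = 1\<close>.\<close>
    define d where "d = (if c < 1 then 2 else 1/2 :: real)"
    define u where "u = (1 - c) / (d - c)"
    have d: "d > 0" "d \<noteq> c" "0 < u" "u < 1"
      using False c by (auto simp: d_def u_def field_simps)
    have "u * (d - c) = 1 - c"
      using d(2) by (simp add: u_def)
    then have "(1 - u) * c + u * d = 1"
      by (simp add: algebra_simps)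
    then have "x = (1 - u) *\<^sub>R (c *\<^sub>R x) + u *\<^sub>R (d *\<^sub>R x)"
      by (simp flip: scaleR_add_left)
    then have "x \<in> open_segment (c *\<^sub>R x) (d *\<^sub>R x)"
      unfolding in_segment using d False by auto
    moreover have "c *\<^sub>R x \<in> D" "d *\<^sub>R x \<in> D"
      using assms x c d by (auto simp: cone_at_origin_def face_of_def)
    ultimately show ?thesis
      using assms(2) x unfolding face_of_def by blast
  qed (use x in auto)
qed

text \<open>A nonzero point \<open>x\<close> of the face is the midpoint of 0 and
  \<open>2 x\<close>.\<close>

lemma zero_in_face_of_cone_at_origin:
  assumes "cone_at_origin D" "F face_of D" "F \<noteq> {}" "0 \<in> D"
  shows "0 \<in> F"
proof -
  obtain x where x: "x \<in> F" using assms(3) by blast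
  show ?thesis
  proof (cases "x = 0")
    case False
    have "x = (1 - 1/2) *\<^sub>R 0 + (1/2) *\<^sub>R (2 *\<^sub>R x)" by simp
    then have "x \<in> open_segment 0 (2 *\<^sub>R x)"
      unfolding in_segment using False by (intro conjI exI[of _ "1/2"]) auto
    moreover have "2 *\<^sub>R x \<in> D"
      using assms x by (auto simp: cone_at_origin_def face_of_def)
    ultimately show ?thesis
      using assms x unfolding face_of_def by blast
  qed (use x in simp)
qed

text \<open>Cutting with \<open>P\<close> removes at most the vertex, because \<open>P\<close> is
  closed under positive multiples. As \<open>Q\<close> is convex, its cone hull is also its convex
  cone hull, the form to which facts on polyhedra apply.\<close>

lemma polyhedral_cone_inE:
  assumes "polyhedral_cone_in P D" "cone_at_origin P" "D \<noteq> {}"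
  obtains Q where "polytope Q" "Q \<subseteq> D" "insert 0 D = convex_cone hull Q"
    "\<And>x. x \<in> D \<Longrightarrow> x \<noteq> 0 \<Longrightarrow> \<exists>c>0. \<exists>q\<in>Q. x = c *\<^sub>R q"
    "0 \<in> P \<Longrightarrow> 0 \<in> D" "D \<subseteq> P"
proof -
  obtain Q where Q: "polytope Q" "Q \<subseteq> P" "D = (cone hull Q) \<inter> P"
    using assms(1) by (auto simp: polyhedral_cone_in_def)
  have ne: "Q \<noteq> {}"
    using Q(3) assms(3) hull_unique[of "{}" "{}" cone] by auto
  have hull: "cone hull Q = {c *\<^sub>R x | c x. c \<ge> 0 \<and> x \<in> Q}"
    using cone_hull_expl .
  have 0: "0 \<in> cone hull Q"
    unfolding hull using ne by force
  have "convex_cone hull Q = conic hull Q"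
    using convex_cone_hull_separate_nonempty[OF ne] Q(1)
    by (simp add: convex_hull_eq polytope_imp_convex hull_same)
  also have "\<dots> = cone hull Q" unfolding hull conic_hull_explicit by auto
  finally have eq: "convex_cone hull Q = cone hull Q" .
  have sub: "cone hull Q \<subseteq> insert 0 P"
  proof
    fix x assume "x \<in> cone hull Q"
    then obtain c q where "x = c *\<^sub>R q" "c \<ge> 0" "q \<in> Q" unfolding hull by auto
    then show "x \<in> insert 0 P"
      using Q(2) assms(2) by (cases "c = 0") (auto simp: cone_at_origin_def)
  qed
  have "insert 0 D = convex_cone hull Q"
    unfolding eq Q(3) using sub 0 by blast
  moreover have "\<exists>c>0. \<exists>q\<in>Q. x = c *\<^sub>R q" if "x \<in> D" "x \<noteq> 0" for x
  proof -
    obtain c q where "x = c *\<^sub>R q" "c \<ge> 0" "q \<in> Q"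
      using \<open>x \<in> D\<close> unfolding Q(3) hull by blast
    then show ?thesis
      using that(2) by (metis order_le_less scaleR_zero_left)
  qed
  moreover have "Q \<subseteq> D"
    unfolding Q(3) using Q(2) hull_subset[of Q cone] by blast
  ultimately show thesis
    using that[of Q] Q 0 by blast
qed

lemma cone_at_origin_polyhedral_cone_in:
  assumes "polyhedral_cone_in P D" "cone_at_origin P"
  shows "cone_at_origin D"
proof -
  obtain Q where "D = (cone hull Q) \<inter> P"
    using assms(1) by (auto simp: polyhedral_cone_in_def)
  moreover have "cone (cone hull Q)" by (rule cone_cone_hull)
  ultimately show ?thesis
    using assms(2) by (auto simp: cone_at_origin_def cone_def)
qed

text \<open>The vertex may be missing from \<open>P\<close>, so \<open>D\<close> itself need not be closed.\<close>

lemma polyhedron_polyhedral_cone_in: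
  assumes "polyhedral_cone_in P D" "cone_at_origin P" "D \<noteq> {}"
  shows "polyhedron (insert 0 D)"
  by (rule polyhedral_cone_inE[OF assms]) (simp add: polyhedron_convex_cone_hull_polytope)

text \<open>If the vertex is missing, convexity is not inherited from \<open>insert 0 D\<close>
  directly. Instead a convex combination of positive multiples of points of \<open>Q\<close> is
  again a positive multiple of a point of \<open>Q\<close>.\<close>

lemma convex_polyhedral_cone_in:
  assumes "polyhedral_cone_in P D" "cone_at_origin P" "D \<noteq> {}"
  shows "convex D"
proof -
  obtain Q where Q: "polytope Q" "Q \<subseteq> D" "insert 0 D = convex_cone hull Q"
    "\<And>x. x \<in> D \<Longrightarrow> x \<noteq> 0 \<Longrightarrow> \<exists>c>0. \<exists>q\<in>Q. x = c *\<^sub>R q"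
    "0 \<in> P \<Longrightarrow> 0 \<in> D" "D \<subseteq> P"
    using polyhedral_cone_inE[OF assms] by blast
  have cD: "cone_at_origin D"
    using assms cone_at_origin_polyhedral_cone_in by blast
  have conv: "convex (insert 0 D)"
    unfolding Q(3) by (rule convex_convex_cone_hull)
  show ?thesis
  proof (cases "0 \<in> D")
    case True
    then show ?thesis using conv by (simp add: insert_absorb)
  next
    case False
    show ?thesis
      unfolding convex_alt
    proof (intro ballI allI impI)
      fix x y u assume xy: "x \<in> D" "y \<in> D" and u: "0 \<le> u \<and> u \<le> (1::real)"
      obtain c q where x: "c > 0" "q \<in> Q" "x = c *\<^sub>R q" using Q(4) xy False by metis
      obtain d r where y: "d > 0" "r \<in> Q" "y = d *\<^sub>R r" using Q(4) xy False by metis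
      \<comment> \<open>The total weight on \<open>q\<close> and \<open>r\<close>; dividing by it
        gives a convex combination inside \<open>Q\<close>.\<close>
      define k where "k = (1 - u) * c + u * d"
      have k: "k > 0"
        using x(1) y(1) u unfolding k_def by (cases "u = 0") (auto intro: add_nonneg_pos)
      have "((1 - u) * c / k) *\<^sub>R q + (u * d / k) *\<^sub>R r \<in> Q"
        using polytope_imp_convex[OF Q(1)] x y u k
        by (intro convexD) (auto simp: k_def simp flip: add_divide_distrib)
      then have "k *\<^sub>R (((1 - u) * c / k) *\<^sub>R q + (u * d / k) *\<^sub>R r) \<in> D"
        using Q(2) cD k by (auto simp: cone_at_origin_def)
      then show "(1 - u) *\<^sub>R x + u *\<^sub>R y \<in> D"
        using k by (simp add: x(3) y(3) scaleR_add_right)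
    qed
  qed
qed

text \<open>Facets are cones, and every nonzero point of \<open>D\<close> is a positive multiple of
  a point of \<open>Q\<close>, so a facet is determined by its trace on \<open>Q\<close>. The traces
  are faces of a polytope, of which there are finitely many.\<close>

lemma finite_facets_polyhedral_cone_in:
  assumes "polyhedral_cone_in P D" "cone_at_origin P"
  shows "finite {F. F facet_of D}"
proof (cases "D = {}")
  case False
  then obtain Q where Q: "polytope Q" "Q \<subseteq> D"
    "\<And>x. x \<in> D \<Longrightarrow> x \<noteq> 0 \<Longrightarrow> \<exists>c>0. \<exists>q\<in>Q. x = c *\<^sub>R q"
    using polyhedral_cone_inE[OF assms] by metis
  have cD: "cone_at_origin D"
    using assms cone_at_origin_polyhedral_cone_in by blast
  have sub: "F \<subseteq> F'" if F: "F facet_of D" "F' facet_of D" and eq: "F \<inter> Q = F' \<inter> Q" for F F'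
  proof
    have face: "F face_of D" "F' face_of D" "F' \<noteq> {}"
      using F by (auto simp: facet_of_def)
    fix x assume x: "x \<in> F"
    then have "x \<in> D" using face by (auto simp: face_of_def)
    show "x \<in> F'"
    proof (cases "x = 0")
      case True
      then show ?thesis
        using zero_in_face_of_cone_at_origin[OF cD face(2,3)] \<open>x \<in> D\<close> by simp
    next
      case False
      then obtain c q where c: "c > 0" "q \<in> Q" "x = c *\<^sub>R q"
        using Q(3) \<open>x \<in> D\<close> by blast
      have "q = (1/c) *\<^sub>R x" using c by simp
      then have "q \<in> F"
        using face_of_cone_at_origin[OF cD face(1)] x c(1)
        by (auto simp: cone_at_origin_def)
      then have "q \<in> F'" using eq c by blast
      then show ?thesis
        using face_of_cone_at_origin[OF cD face(2)] c by (auto simp: cone_at_origin_def)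
    qed
  qed
  show ?thesis
  proof (rule finite_imageD)
    have "(\<lambda>F. F \<inter> Q) ` {F. F facet_of D} \<subseteq> {F. F face_of Q}"
    proof clarify
      fix F assume "F facet_of D"
      then have "(F \<inter> Q) face_of (D \<inter> Q)"
        using polytope_imp_convex[OF Q(1)] by (intro face_of_slice) (auto simp: facet_of_def)
      then show "(F \<inter> Q) face_of Q" using Q(2) by (simp add: Int_absorb1)
    qed
    then show "finite ((\<lambda>F. F \<inter> Q) ` {F. F facet_of D})"
      using finite_polytope_faces[OF Q(1)] finite_subset by blast
    show "inj_on (\<lambda>F. F \<inter> Q) {F. F facet_of D}"
      by (rule inj_onI) (use sub in blast)
  qed
qed (simp add: facet_of_def)

text \<open>In the polyhedron \<open>insert 0 D\<close> a boundary point lies in a facet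
  \<open>F\<close>; if it were outside the relative interior of \<open>F\<close>, it would lie in a
  facet of \<open>F\<close>, which has codimension two. It remains to pass from \<open>F\<close> to
  \<open>F \<inter> D\<close>, which can differ only in the vertex.\<close>

lemma boundary_point_of_polyhedral_cone_in:
  fixes D :: "(real ^ 'n) set"
  assumes D: "polyhedral_cone_in P D" "cone_at_origin P" "aff_dim D = int CARD('n)"
    and card: "CARD('n) \<ge> 2"
    and x: "x \<in> D" "x \<noteq> 0" "x \<notin> interior D"
    and low: "\<And>E. E face_of insert 0 D \<Longrightarrow> aff_dim E \<le> int CARD('n) - 2 \<Longrightarrow> x \<notin> E"
  obtains F where "F facet_of D" "x \<in> rel_interior F"
proof -
  let ?C = "insert 0 D"
  have ne: "D \<noteq> {}" using x by blast
  have poly: "polyhedron ?C"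
    using polyhedron_polyhedral_cone_in[OF D(1,2) ne] .
  have dimC: "aff_dim ?C = int CARD('n)"
    using aff_dim_subset[OF subset_insertI[of D 0]] aff_dim_le_DIM[of ?C] D(3) by auto
  have "x \<notin> interior ?C"
  proof
    assume "x \<in> interior ?C"
    then obtain T where T: "open T" "x \<in> T" "T \<subseteq> ?C" by (auto simp: interior_def)
    then have "x \<in> T - {0}" "open (T - {0})" "T - {0} \<subseteq> D" using x(2) by auto
    then show False using x(3) interiorI by blast
  qed
  then have "x \<in> ?C - rel_interior ?C"
    using x(1) dimC by (simp add: rel_interior_interior aff_dim_eq_full[symmetric])
  then obtain F where F: "F facet_of ?C" "x \<in> F"
    using rel_boundary_of_polyhedron[OF poly] by blast
  then have face: "F face_of ?C" and dimF: "aff_dim F = int CARD('n) - 1"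
    using dimC by (auto simp: facet_of_def)
  have "x \<in> rel_interior F"
  proof (rule ccontr)
    assume "x \<notin> rel_interior F"
    then obtain E where E: "E facet_of F" "x \<in> E"
      using rel_boundary_of_polyhedron[OF face_of_polyhedron_polyhedron[OF poly face]] F(2) by blast
    then have "E face_of ?C" "aff_dim E \<le> int CARD('n) - 2"
      using face face_of_trans dimF by (auto simp: facet_of_def)
    then show False using low E(2) by blast
  qed
  let ?F = "F \<inter> D"
  have conv: "convex D" using convex_polyhedral_cone_in[OF D(1,2) ne] .
  have "?F face_of (?C \<inter> D)"
    using face_of_slice[OF face conv] .
  then have faceD: "?F face_of D" by (simp add: Int_absorb1 subset_insertI)
  \<comment> \<open>The line through \<open>x\<close> and \<open>2 x\<close> passes through 0, so
    removing the vertex from \<open>F\<close> changes neither affine hull nor dimension.\<close>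
  have "2 *\<^sub>R x \<in> ?F"
    using face_of_cone_at_origin[OF cone_at_origin_polyhedral_cone_in[OF D(1,2)] faceD] x F
    by (auto simp: cone_at_origin_def)
  then have "0 \<in> affine hull ?F"
    using mem_affine[OF affine_affine_hull, of x ?F "2 *\<^sub>R x" 2 "-1"] x F hull_inc[of _ ?F affine]
    by auto
  moreover have "F \<subseteq> insert 0 ?F"
    using face by (auto simp: face_of_def)
  moreover have "?F \<subseteq> affine hull ?F" by (rule hull_subset)
  ultimately have "F \<subseteq> affine hull ?F" by blast
  then have hull: "affine hull ?F = affine hull F"
    by (metis hull_mono hull_minimal affine_affine_hull inf_le1 subset_antisym)
  have "?F facet_of D"
    using faceD x F dimF D(3) aff_dim_affine_hull[of F] aff_dim_affine_hull[of ?F] hull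
    by (auto simp: facet_of_def)
  moreover have "x \<in> rel_interior ?F"
  proof -
    \<comment> \<open>Since \<open>x\<close> is not 0, a neighbourhood of \<open>x\<close> can be
      shrunk to miss the vertex.\<close>
    obtain T where "open T" "x \<in> T" "T \<inter> affine hull F \<subseteq> F"
      using \<open>x \<in> rel_interior F\<close> by (auto simp: mem_rel_interior)
    then have "open (T - {0})" "x \<in> (T - {0}) \<inter> ?F" "(T - {0}) \<inter> affine hull ?F \<subseteq> ?F"
      using x F face hull by (auto simp: face_of_def)
    then show ?thesis by (auto simp: mem_rel_interior)
  qed
  ultimately show thesis using that by blast
qed

section \<open>Galleries of chambers\<close>

context exact_tessellation
begin

lemma chamber_nonempty: "i \<in> I \<Longrightarrow> D i \<noteq> {}"
  using full_dim_D[of i] by force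

lemma convex_chamber: "i \<in> I \<Longrightarrow> convex (D i)"
  using convex_polyhedral_cone_in polyhedral_cone_D cone_P chamber_nonempty by blast

lemma chamber_subset: "i \<in> I \<Longrightarrow> D i \<subseteq> P"
  using polyhedral_cone_D by (auto simp: polyhedral_cone_in_def)

lemma interior_chamber_nonempty: "i \<in> I \<Longrightarrow> interior (D i) \<noteq> {}"
  using full_dim_D[of i] convex_chamber[of i] rel_interior_eq_empty[of "D i"] chamber_nonempty[of i]
  by (simp add: rel_interior_interior flip: aff_dim_eq_full)

lemma negligible_chamber_Int:
  assumes "i \<in> I" "i' \<in> I" "i \<noteq> i'"
  shows "negligible (D i \<inter> D i')"
  using face_to_face[OF assms] by (auto intro!: negligible_aff_dim_less)

lemma inj_on_chamber: "inj_on D I"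
proof (rule inj_onI, rule ccontr)
  fix i i' assume *: "i \<in> I" "i' \<in> I" "D i = D i'" "i \<noteq> i'"
  then have "negligible (D i)"
    using negligible_chamber_Int[of i i'] by simp
  then show False
    using open_not_subset_negligible[of "interior (D i)" "D i"] interior_chamber_nonempty * interior_subset
    by blast
qed

text \<open>The interiors are disjoint nonempty open sets in a Euclidean space, and distinct indices
  have distinct interiors.\<close>

lemma countable_chambers: "countable I"
proof -
  have "countable ((\<lambda>i. interior (D i)) ` I)"
  proof (rule countable_disjoint_nonempty_interior_subsets)
    have "interior (D i) \<inter> interior (D i') = {}" if "i \<in> I" "i' \<in> I" "i \<noteq> i'" for i i'
      using open_not_subset_negligible[OF _ _ negligible_chamber_Int[OF that],
          of "interior (D i) \<inter> interior (D i')"] interior_subset by blast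
    then show "pairwise disjnt ((\<lambda>i. interior (D i)) ` I)"
      unfolding pairwise_image disjnt_def by (metis (mono_tags, lifting) pairwiseI)
  qed auto
  moreover have "inj_on (\<lambda>i. interior (D i)) I"
  proof (rule inj_onI, rule ccontr)
    fix i i' assume *: "i \<in> I" "i' \<in> I" "interior (D i) = interior (D i')" "i \<noteq> i'"
    then show False
      using open_not_subset_negligible[OF _ _ negligible_chamber_Int[OF *(1,2,4)], of "interior (D i)"]
        interior_subset interior_chamber_nonempty by blast
  qed
  ultimately show ?thesis by (rule countable_image_inj_on)
qed

text \<open>Uniqueness of neighbours only provides \<open>i'\<close> with
  \<open>D i \<inter> D i' = F\<close>. That \<open>F\<close> is also a facet of \<open>D i'\<close>
  follows from the face-to-face condition and a comparison of dimensions.\<close>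

lemma facet_neighbour:
  assumes i: "i \<in> I" and F: "F facet_of D i"
  obtains i' where "i' \<in> I" "D i \<inter> D i' = F" "adjacent D i i'"
proof -
  obtain i' where i': "i' \<in> I" "D i \<inter> D i' = F"
    using unique_neighbour[OF i F] by blast
  have dim: "aff_dim F = int CARD('n) - 1" "F \<noteq> {}"
    using F full_dim_D[OF i] by (auto simp: facet_of_def)
  have "i \<noteq> i'"
    using dim i' full_dim_D[OF i] by auto
  then have "F face_of D i'"
    using face_to_face[OF i i'(1)] i'(2) dim by auto
  then have "adjacent D i i'"
    using F i' dim full_dim_D[OF i'(1)] \<open>i \<noteq> i'\<close> by (auto simp: adjacent_def facet_of_def)
  then show thesis using that i' by blast
qed

lemma adjacent_sym: "adjacent D i i' \<Longrightarrow> adjacent D i' i"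
  by (auto simp: adjacent_def Int_commute)

lemma P_eq_Union_chambers:
  assumes "i \<in> I"
  shows "P = (\<Union>i\<in>I. D i)"
proof -
  interpret T: transitive_action G "D ` I" "\<lambda>g. restrict (setwise \<phi> g) (D ` I)"
    by (rule transitive)
  have "\<phi> g ` D i \<in> D ` I" if "g \<in> carrier G" for g
    using T.element_image[OF that, of "D i"] assms by (simp add: setwise_def)
  then have "P \<subseteq> (\<Union>i\<in>I. D i)"
    using covers[OF assms] by blast
  then show ?thesis using chamber_subset by blast
qed

text \<open>The vertex is included because facets of \<open>insert 0 (D i)\<close> and of \<open>D i\<close> agree only away from it.\<close>

definition thin_faces :: "(real ^ 'n) set set" where
  "thin_faces = insert {0} (\<Union>i\<in>I. {E. E face_of insert 0 (D i) \<and> aff_dim E \<le> int CARD('n) - 2})"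

lemma countable_thin_faces: "countable thin_faces"
proof -
  have "countable {E. E face_of insert 0 (D i) \<and> aff_dim E \<le> int CARD('n) - 2}" if "i \<in> I" for i
    using finite_polyhedron_faces[OF polyhedron_polyhedral_cone_in[OF polyhedral_cone_D[OF that] cone_P chamber_nonempty[OF that]]]
    by (intro countable_finite) (auto elim: rev_finite_subset)
  then show ?thesis
    using countable_chambers by (simp add: thin_faces_def)
qed

text \<open>The vertex has dimension 0, so including it is harmless as soon as the space has
  dimension at least two.\<close>

lemma aff_dim_thin_faces: "E \<in> thin_faces \<Longrightarrow> aff_dim E \<le> int CARD('n) - 2"
  using dim_ge_2 by (auto simp: thin_faces_def)

text \<open>Off the thin faces, \<open>x\<close> is either interior to \<open>D i\<close> or in the
  relative interior of a facet, where \<open>D i\<close> and its neighbour across that facet fill a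
  neighbourhood of \<open>x\<close>.\<close>

lemma interior_Un_adjacent:
  assumes i: "i \<in> I" and x: "x \<in> D i" "x \<notin> \<Union>thin_faces"
  obtains i' where "i' \<in> I" "i' = i \<or> adjacent D i i'" "x \<in> interior (D i \<union> D i')"
proof (cases "x \<in> interior (D i)")
  case True
  then show thesis using that[of i] i by simp
next
  case False
  obtain F where F: "F facet_of D i" "x \<in> rel_interior F"
    using boundary_point_of_polyhedral_cone_in[OF polyhedral_cone_D[OF i] cone_P full_dim_D[OF i] dim_ge_2 x(1) _ False]
      x i by (auto simp: thin_faces_def)
  obtain i' where i': "i' \<in> I" "D i \<inter> D i' = F" "adjacent D i i'"
    using facet_neighbour[OF i F(1)] .
  have "x \<in> interior (D i \<union> D i')"
    using F i' i full_dim_D convex_chamber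
    by (intro interior_Un_of_common_facet) (auto simp: facet_of_def)
  then show thesis using that i' by blast
qed

text \<open>If \<open>k\<close> were outside \<open>K\<close>, a generic segment in \<open>B\<close>
  from \<open>D i\<close> to \<open>D k\<close> would be split by two disjoint open sets, one made
  from chambers in \<open>K\<close> and one from the others. Each point of the segment belongs to
  one of them because adjacent chambers are on the same side of the partition.\<close>

lemma adjacency_closed_in_convex:
  assumes K: "K \<subseteq> I" "\<And>i i'. i \<in> K \<Longrightarrow> i' \<in> I \<Longrightarrow> adjacent D i i' \<Longrightarrow> i' \<in> K"
    and B: "open B" "convex B" "B \<subseteq> P"
    and i: "i \<in> K" "interior (D i) \<inter> B \<noteq> {}" and k: "k \<in> I" "interior (D k) \<inter> B \<noteq> {}"
  shows "k \<in> K"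
proof (rule ccontr)
  assume "k \<notin> K"
  obtain x y where x: "x \<in> interior (D i) \<inter> B" and y: "y \<in> interior (D k) \<inter> B"
    and avoid: "closed_segment x y \<inter> \<Union>thin_faces = {}"
  proof (rule generic_segment[of "interior (D i) \<inter> B" "interior (D k) \<inter> B" thin_faces])
    show "aff_dim E \<le> int DIM(real ^ 'n) - 2" if "E \<in> thin_faces" for E
      using aff_dim_thin_faces[OF that] by simp
  qed (use countable_thin_faces B i k in blast)+
  \<comment> \<open>The case \<open>j = j'\<close> is included, so \<open>N A\<close> contains the
    interiors of the chambers as well as the points inside common facets.\<close>
  define N where "N A = (\<Union>j\<in>A. \<Union>j'\<in>A. interior (D j \<union> D j'))" for A
  have "open (N K)" "open (N (I - K))" by (auto simp: N_def)
  moreover have "N K \<inter> N (I - K) = {}"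
  proof (rule ccontr)
    assume "N K \<inter> N (I - K) \<noteq> {}"
    then obtain j j' l l' where jl: "j \<in> K" "j' \<in> K" "l \<in> I - K" "l' \<in> I - K"
      and ne: "interior (D j \<union> D j') \<inter> interior (D l \<union> D l') \<noteq> {}"
      unfolding N_def by blast
    \<comment> \<open>A common point of the two open sets lies in one of these four intersections,
      but a nonempty open set is not negligible.\<close>
    have "negligible ((D j \<inter> D l) \<union> (D j \<inter> D l') \<union> (D j' \<inter> D l) \<union> (D j' \<inter> D l'))"
      using jl K(1) by (intro negligible_Un negligible_chamber_Int) auto
    then show False
      using open_not_subset_negligible[OF _ ne] interior_subset[of "D j \<union> D j'"] interior_subset[of "D l \<union> D l'"]
      by blast
  qed
  moreover have "closed_segment x y \<subseteq> N K \<union> N (I - K)"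
  proof
    fix z assume z: "z \<in> closed_segment x y"
    then have "z \<in> P"
      using closed_segment_subset[of x B y] x y B by blast
    then obtain j where j: "j \<in> I" "z \<in> D j"
      using P_eq_Union_chambers[OF k(1)] by blast
    then obtain j' where j': "j' \<in> I" "j' = j \<or> adjacent D j j'" "z \<in> interior (D j \<union> D j')"
      using interior_Un_adjacent[of j z] z avoid by blast
    then have "j' \<in> K \<longleftrightarrow> j \<in> K"
      using K j adjacent_sym by blast
    then show "z \<in> N K \<union> N (I - K)"
      using j j' unfolding N_def by blast
  qed
  moreover have "x \<in> N K" "y \<in> N (I - K)"
    using i k x y \<open>k \<notin> K\<close> unfolding N_def by fastforce+
  ultimately show False
    using connected_segment[of x y] ends_in_segment[of x y] unfolding connected_def by blast
qed

text \<open>A convex set with nonempty interior lies in the closure of its interior.\<close>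

lemma chamber_meets_open:
  assumes "i \<in> I" "open B" "x \<in> D i" "x \<in> B"
  shows "interior (D i) \<inter> B \<noteq> {}"
proof -
  have "x \<in> closure (interior (D i))"
    using convex_closure_interior[OF convex_chamber interior_chamber_nonempty] assms closure_subset
    by blast
  then show ?thesis
    using assms open_Int_closure_eq_empty[of B "interior (D i)"] by blast
qed

theorem adjacency_connected:
  assumes int: "connected (interior P)"
    and K: "K \<subseteq> I" "K \<noteq> {}" "\<And>i i'. i \<in> K \<Longrightarrow> i' \<in> I \<Longrightarrow> adjacent D i i' \<Longrightarrow> i' \<in> K"
  shows "K = I"
proof -
  \<comment> \<open>A point may lie in several chambers, so all of them are quantified over.
    Transitivity then requires a chamber through the middle point; locally \<open>R\<close> holds
    because balls are convex.\<close>
  define R where "R p q \<longleftrightarrow> (\<forall>i\<in>I. \<forall>k\<in>I. p \<in> D i \<longrightarrow> q \<in> D k \<longrightarrow> (i \<in> K \<longleftrightarrow> k \<in> K))" for p q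
  obtain i where i: "i \<in> K" "i \<in> I" using K by blast
  have R: "R p q" if "p \<in> interior P" "q \<in> interior P" for p q
  proof (rule connected_equivalence_relation[OF int that])
    show "R y x" if "R x y" for x y
      using that unfolding R_def by blast
    show "R x z" if yz: "R x y" "R y z" "y \<in> interior P" for x y z
    proof -
      obtain j where "j \<in> I" "y \<in> D j"
        using yz(3) interior_subset P_eq_Union_chambers[OF i(2)] by blast
      then show ?thesis using yz(1,2) unfolding R_def by blast
    qed
    fix x assume "x \<in> interior P"
    then obtain e where e: "e > 0" "ball x e \<subseteq> interior P"
      using open_contains_ball[of "interior P"] by auto
    have "R x y" if "y \<in> ball x e" for y
      unfolding R_def
    proof (intro ballI impI)
      fix j k assume jk: "j \<in> I" "k \<in> I" "x \<in> D j" "y \<in> D k"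
      have meets: "interior (D j) \<inter> ball x e \<noteq> {}" "interior (D k) \<inter> ball x e \<noteq> {}"
        using chamber_meets_open[OF _ open_ball] jk e that by (metis centre_in_ball)+
      have sub: "ball x e \<subseteq> P" using e interior_subset by blast
      have "l' \<in> K" if "l \<in> K" "l' \<in> I" "interior (D l) \<inter> ball x e \<noteq> {}"
        "interior (D l') \<inter> ball x e \<noteq> {}" for l l'
        by (rule adjacency_closed_in_convex[OF K(1) _ open_ball convex_ball sub that(1,3,2,4)])
          (rule K(3))
      then show "j \<in> K \<longleftrightarrow> k \<in> K"
        using meets jk by blast
    qed
    then show "\<exists>T. openin (top_of_set (interior P)) T \<and> x \<in> T \<and> (\<forall>y\<in>T. R x y)"
      using e by (intro exI[of _ "ball x e"]) (auto intro: open_openin_trans simp: open_subset)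
  qed
  have "k \<in> K" if k: "k \<in> I" for k
  proof -
    obtain p q where "p \<in> interior (D i)" "q \<in> interior (D k)"
      using interior_chamber_nonempty i k by blast
    moreover have "interior (D i) \<subseteq> interior P" "interior (D k) \<subseteq> interior P"
      using interior_mono chamber_subset i k by blast+
    ultimately show ?thesis
      using R[of p q] i k interior_subset unfolding R_def by blast
  qed
  then show ?thesis using K(1) by blast
qed

end

section \<open>Generators from face pairings\<close>

lemma min_generators_le:
  assumes "finite S" "S \<subseteq> carrier G" "generate G S = carrier G"
  shows "min_generators G \<le> card S"
  unfolding min_generators_def using assms by (intro Least_le) blast

text \<open>For a finite group the minimum ranges over a nonempty set, as the carrier generates
  itself. This serves the finite stabilizers \<open>H_stab j\<close>.\<close>

lemma (in group) min_generators_attained: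
  assumes "finite (carrier G)"
  obtains S where "finite S" "S \<subseteq> carrier G" "card S = min_generators G" "generate G S = carrier G"
proof -
  have "generate G (carrier G) = carrier G"
    using generate_incl[of "carrier G"] generate.incl[of _ "carrier G" G] by blast
  then have "\<exists>n S. finite S \<and> S \<subseteq> carrier G \<and> card S = n \<and> generate G S = carrier G"
    using assms by blast
  from LeastI_ex[OF this] show thesis
    using that unfolding min_generators_def by blast
qed

section \<open>The action on chambers and double cosets\<close>

context exact_tessellation
begin

lemma group_G: "group G"
  using group_hom group_hom.axioms(1) by blast

text \<open>The laws of the action hold at points of \<open>P\<close>, which is why sets are
  required to lie in \<open>P\<close> here and below.\<close>

lemma act_mult:
  assumes "g \<in> carrier G" "h \<in> carrier G" "X \<subseteq> P"
  shows "\<phi> (g \<otimes> h) ` X = \<phi> g ` \<phi> h ` X"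
  using assms composition_rule[OF _ assms(1,2)] by (force simp: image_image)

lemma act_subset: "g \<in> carrier G \<Longrightarrow> X \<subseteq> P \<Longrightarrow> \<phi> g ` X \<subseteq> P"
  using surj_prop by blast

lemma act_one: "X \<subseteq> P \<Longrightarrow> \<phi> \<one> ` X = X"
  using image_cong[of X X "\<phi> \<one>" "\<lambda>x. x"] by (auto simp flip: id_eq_one)

lemma act_inv:
  assumes "g \<in> carrier G" "X \<subseteq> P" "\<phi> g ` X = Y"
  shows "\<phi> (inv g) ` Y = X"
proof -
  interpret group G by (rule group_G)
  show ?thesis
    using act_mult[of "inv g" g X] act_one[of X] assms by simp
qed

lemma act_Int:
  assumes "g \<in> carrier G" "X \<subseteq> P" "Y \<subseteq> P"
  shows "\<phi> g ` (X \<inter> Y) = \<phi> g ` X \<inter> \<phi> g ` Y"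
  using inj_on_image_Int[OF inj_prop] assms by blast

lemma act_chamber:
  assumes "g \<in> carrier G" "i \<in> I"
  obtains k where "k \<in> I" "\<phi> g ` D i = D k"
proof -
  interpret T: transitive_action G "D ` I" "\<lambda>g. restrict (setwise \<phi> g) (D ` I)"
    by (rule transitive)
  have "\<phi> g ` D i \<in> D ` I"
    using T.element_image[OF assms(1), of "D i"] assms by (simp add: setwise_def)
  then show thesis using that by blast
qed

lemma act_chamber_transitive:
  assumes "i \<in> I" "k \<in> I"
  obtains g where "g \<in> carrier G" "\<phi> g ` D i = D k"
proof -
  interpret T: transitive_action G "D ` I" "\<lambda>g. restrict (setwise \<phi> g) (D ` I)"
    by (rule transitive)
  show thesis
    using that T.unique_orbit[of "D i" "D k"] assms by (auto simp: setwise_def)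
qed

text \<open>The action is only by homeomorphisms, so this rests on the topological invariance of
  dimension for convex sets.\<close>

lemma aff_dim_act:
  assumes g: "g \<in> carrier G" and X: "X \<subseteq> P" "convex X" "convex (\<phi> g ` X)"
  shows "aff_dim (\<phi> g ` X) = aff_dim X"
proof -
  interpret group G by (rule group_G)
  have inv: "\<phi> (inv g) (\<phi> g x) = x" if "x \<in> X" for x
    using orbit_sym_aux[OF g, of x] that X by blast
  have "homeomorphism X (\<phi> g ` X) (\<phi> g) (\<phi> (inv g))"
  proof (rule homeomorphismI)
    show "continuous_on X (\<phi> g)" "continuous_on (\<phi> g ` X) (\<phi> (inv g))"
      using continuous_action continuous_on_subset g X act_subset by (meson inv_closed)+
  qed (use inv in auto)
  then have "X homeomorphic \<phi> g ` X"
    unfolding homeomorphic_def by blast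
  then show ?thesis
    using homeomorphic_convex_sets X by metis
qed

text \<open>A homeomorphism need not carry faces to faces. But the image of the common facet is the
  intersection of the two image chambers, hence a common face, and its dimension is
  preserved.\<close>

lemma act_adjacent:
  assumes g: "g \<in> carrier G" and I: "i \<in> I" "k \<in> I" "i' \<in> I" "k' \<in> I"
    and i': "\<phi> g ` D i = D i'" and k': "\<phi> g ` D k = D k'" and adj: "adjacent D i k"
  shows "adjacent D i' k'"
proof -
  have "i' \<noteq> k'"
  proof
    assume "i' = k'"
    then have "D i = D k"
      using act_inv[OF g _ i'] act_inv[OF g _ k'] I chamber_subset by metis
    then show False
      using adj I inj_on_chamber by (auto simp: adjacent_def inj_on_def)
  qed
  have eq: "\<phi> g ` (D i \<inter> D k) = D i' \<inter> D k'"
    using act_Int[OF g] I chamber_subset i' k' by simp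
  then have ne: "D i' \<inter> D k' \<noteq> {}"
    using adj by (auto simp: adjacent_def facet_of_def)
  have "aff_dim (D i' \<inter> D k') = aff_dim (D i \<inter> D k)"
    using aff_dim_act[OF g, of "D i \<inter> D k"] I chamber_subset convex_chamber eq
    by (metis convex_Int le_infI1)
  then show ?thesis
    using face_to_face[OF I(3,4) \<open>i' \<noteq> k'\<close>] ne adj I full_dim_D \<open>i' \<noteq> k'\<close>
    by (auto simp: adjacent_def facet_of_def)
qed

lemma subgroup_set_stabilizer:
  assumes "X \<subseteq> P"
  shows "subgroup (stabilizer G (setwise \<phi>) X) G"
proof -
  interpret group G by (rule group_G)
  show ?thesis
  proof
    show "\<one> \<in> stabilizer G (setwise \<phi>) X"
      using act_one assms by (simp add: stabilizer_def setwise_def)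
  qed (use act_mult act_inv assms in \<open>auto simp: stabilizer_def setwise_def\<close>)
qed

text \<open>Send a chamber \<open>g (D i\<^sub>0)\<close> to the double coset \<open>H g K\<close>.
  Chambers with the same double coset are equivalent under \<open>H\<close>, so this map is
  injective on \<open>J\<close>, and by the cardinality of \<open>J\<close> it is onto the finite
  set of double cosets.\<close>

lemma orbit_representatives:
  assumes H: "subgroup H G" "finite (rcosets H)" and i0: "i\<^sub>0 \<in> I"
    and J: "fundamental H P \<phi> I D J"
      "card J = card (double_cosets G H (stabilizer G (setwise \<phi>) (D i\<^sub>0)))"
    and i: "i \<in> I"
  obtains h j where "h \<in> H" "j \<in> J" "\<phi> h ` D j = D i"
proof -
  interpret group G by (rule group_G)
  define K where "K = stabilizer G (setwise \<phi>) (D i\<^sub>0)"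
  have sub: "H \<subseteq> carrier G" using H(1) by (rule subgroup.subset)
  have "\<exists>\<gamma>. \<forall>k\<in>I. \<gamma> k \<in> carrier G \<and> \<phi> (\<gamma> k) ` D i\<^sub>0 = D k"
    using act_chamber_transitive[OF i0] by (intro bchoice) blast
  then obtain \<gamma> where \<gamma>: "\<And>k. k \<in> I \<Longrightarrow> \<gamma> k \<in> carrier G \<and> \<phi> (\<gamma> k) ` D i\<^sub>0 = D k"
    by blast
  define f where "f k = (H #> \<gamma> k) <#> K" for k
  have f_dc: "f k \<in> double_cosets G H K" if "k \<in> I" for k
    using \<gamma>[OF that] unfolding f_def double_cosets_def by blast
  have key: "\<exists>h\<in>H. \<phi> h ` D k = D k'" if k: "k \<in> I" "k' \<in> I" "f k = f k'" for k k'
  proof -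
    have "\<one> \<in> K"
      using subgroup_set_stabilizer[OF chamber_subset[OF i0]] subgroup.one_closed K_def by blast
    then have "\<gamma> k' \<otimes> \<one> \<in> f k'"
      using rcos_self[OF _ H(1)] \<gamma>[OF k(2)] unfolding f_def set_mult_def by blast
    then have "\<gamma> k' \<in> f k" using \<gamma>[OF k(2)] k(3) by simp
    then obtain h x where hx: "h \<in> H" "x \<in> K" "\<gamma> k' = h \<otimes> \<gamma> k \<otimes> x"
      unfolding f_def set_mult_def r_coset_def by blast
    then have x: "x \<in> carrier G" "\<phi> x ` D i\<^sub>0 = D i\<^sub>0"
      by (auto simp: K_def stabilizer_def setwise_def)
    have "D k' = \<phi> (h \<otimes> \<gamma> k \<otimes> x) ` D i\<^sub>0"
      using \<gamma>[OF k(2)] hx by simp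
    also have "\<dots> = \<phi> h ` D k"
      using act_mult x hx sub \<gamma>[OF k(1)] chamber_subset[OF i0] by (simp add: subset_iff)
    finally show ?thesis using hx by blast
  qed
  have "J \<subseteq> I" using J(1) by (simp add: fundamental_def)
  have "inj_on f J"
    using key J(1) \<open>J \<subseteq> I\<close> unfolding inj_on_def fundamental_def by (metis subsetD)
  then have "card (f ` J) = card (double_cosets G H K)"
    using J(2) by (simp add: card_image K_def)
  \<comment> \<open>Every double coset is a right coset of \<open>H\<close> multiplied by
    \<open>K\<close>, so finite index suffices.\<close>
  moreover have "finite (double_cosets G H K)"
  proof (rule finite_subset)
    show "double_cosets G H K \<subseteq> (\<lambda>R. R <#> K) ` (rcosets H)"
      unfolding double_cosets_def RCOSETS_def by blast
  qed (use H(2) in simp)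
  moreover have "f ` J \<subseteq> double_cosets G H K" using f_dc \<open>J \<subseteq> I\<close> by blast
  ultimately have "f ` J = double_cosets G H K" by (intro card_subset_eq) auto
  then obtain j where "j \<in> J" "f j = f i" using f_dc[OF i] by (metis imageE)
  then show thesis using key[of j i] i \<open>J \<subseteq> I\<close> that by blast
qed

end

lemma fundamental_eqD:
  assumes "fundamental H P \<phi> I D J" "j \<in> J" "j' \<in> J" "g \<in> H" "\<phi> g ` D j = D j'"
  shows "j = j'"
proof -
  have "\<forall>j\<in>J. \<forall>j'\<in>J. j \<noteq> j' \<longrightarrow> (\<forall>g\<in>H. \<phi> g ` D j \<noteq> D j')"
    using assms(1) by (simp add: fundamental_def)
  then show ?thesis using assms(2-) by blast
qed

section \<open>Face pairings generate the subgroup\<close>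

context exact_tessellation
begin

lemma neighbour_unique:
  assumes "adjacent D i k" "i \<in> I" "k \<in> I" "k' \<in> I" "D i \<inter> D k' = D i \<inter> D k"
  shows "k' = k"
  using unique_neighbour[OF assms(2), of "D i \<inter> D k"] assms by (auto simp: adjacent_def)

lemma act_Int_stabilizer:
  assumes g: "g \<in> stabilizer G (setwise \<phi>) (D j)" and j: "j \<in> I" and X: "X \<subseteq> P"
  shows "\<phi> g ` (D j \<inter> X) = D j \<inter> \<phi> g ` X"
  using act_Int[of g "D j" X] g X chamber_subset[OF j] by (auto simp: stabilizer_def setwise_def)

text \<open>The chambers that are \<open>L\<close>-translates of chambers in \<open>J\<close> are
  closed under adjacency, hence are all chambers. For \<open>g\<close> in \<open>H\<close> this
  gives \<open>l\<close> in \<open>L\<close> with \<open>g (D j) = l (D j')\<close>; then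
  \<open>j = j'\<close> as \<open>J\<close> is fundamental, and \<open>inv l \<otimes> g\<close>
  stabilizes \<open>D j\<close>.\<close>

lemma subgroup_generated_by_face_pairings:
  assumes int: "connected (interior P)"
    and H: "subgroup H G" and J: "fundamental H P \<phi> I D J" "J \<noteq> {}"
    and L: "subgroup L G" "L \<subseteq> H"
    and stab: "\<And>j. j \<in> J \<Longrightarrow> stabilizer G (setwise \<phi>) (D j) \<inter> H \<subseteq> L"
    and pair: "\<And>j i. j \<in> J \<Longrightarrow> i \<in> I \<Longrightarrow> adjacent D j i \<Longrightarrow> \<exists>l\<in>L. \<exists>j'\<in>J. \<phi> l ` D j' = D i"
  shows "L = H"
proof -
  interpret group G by (rule group_G)
  have "J \<subseteq> I" using J(1) by (simp add: fundamental_def)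
  note sub = subgroup.subset[OF H] subgroup.subset[OF L(1)]
  have DP: "D j \<subseteq> P" if "j \<in> J" for j using that \<open>J \<subseteq> I\<close> chamber_subset by blast
  define A where "A = {i \<in> I. \<exists>l\<in>L. \<exists>j\<in>J. \<phi> l ` D j = D i}"
  have "A = I"
  proof (rule adjacency_connected[OF int])
    have "J \<subseteq> A"
      using \<open>J \<subseteq> I\<close> act_one DP subgroup.one_closed[OF L(1)] unfolding A_def by blast
    then show "A \<noteq> {}" using J(2) by blast
    fix i i' assume i: "i \<in> A" and i': "i' \<in> I" and adj: "adjacent D i i'"
    then obtain l j where l: "l \<in> L" "j \<in> J" "\<phi> l ` D j = D i" "i \<in> I"
      unfolding A_def by blast
    have lG: "l \<in> carrier G" using l sub by blast
    \<comment> \<open>The neighbour is moved back next to \<open>D j\<close>, where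
      \<open>pair\<close> applies, and the result is moved forward again by
      \<open>l\<close>.\<close>
    obtain k where k: "k \<in> I" "\<phi> (inv l) ` D i' = D k"
      using act_chamber[OF inv_closed[OF lG] i'] .
    have "adjacent D j k"
      using act_adjacent[OF inv_closed[OF lG] l(4) i' _ k(1) _ k(2) adj, of j]
        act_inv[OF lG DP[OF l(2)] l(3)] l(2) \<open>J \<subseteq> I\<close> by blast
    then obtain l' j' where l': "l' \<in> L" "j' \<in> J" "\<phi> l' ` D j' = D k"
      using pair l(2) k(1) by blast
    have "\<phi> l ` D k = D i'"
      using act_inv[OF inv_closed[OF lG] chamber_subset[OF i'] k(2)] lG by simp
    then have "\<phi> (l \<otimes> l') ` D j' = D i'"
      using act_mult[OF lG _ DP[OF l'(2)], of l'] l' sub by auto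
    moreover have "l \<otimes> l' \<in> L" using l l' L(1) by (simp add: subgroup.m_closed)
    ultimately show "i' \<in> A" using i' l'(2) unfolding A_def by blast
  qed (auto simp: A_def)
  have "g \<in> L" if g: "g \<in> H" for g
  proof -
    have gG: "g \<in> carrier G" using g sub by blast
    obtain j where j: "j \<in> J" using J(2) by blast
    obtain i where i: "i \<in> I" "\<phi> g ` D j = D i"
      using act_chamber[OF gG, of j] j \<open>J \<subseteq> I\<close> by blast
    then obtain l j' where l: "l \<in> L" "j' \<in> J" "\<phi> l ` D j' = D i"
      using \<open>A = I\<close> unfolding A_def by blast
    have lG: "l \<in> carrier G" using l sub by blast
    have eq: "\<phi> (inv l \<otimes> g) ` D j = D j'"
      using act_mult[OF inv_closed[OF lG] gG DP[OF j]] act_inv[OF lG DP[OF l(2)] l(3)] i by simp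
    have mem: "inv l \<otimes> g \<in> H"
      using l(1) L(2) g H by (meson subgroup.m_closed subgroup.m_inv_closed subsetD)
    have "j = j'"
      using fundamental_eqD[OF J(1) j l(2) mem eq] .
    then have "\<phi> (inv l \<otimes> g) ` D j = D j" using eq by simp
    then have "inv l \<otimes> g \<in> stabilizer G (setwise \<phi>) (D j) \<inter> H"
      using mem sub by (auto simp: stabilizer_def setwise_def)
    then have "inv l \<otimes> g \<in> L" using stab j by blast
    then have "l \<otimes> (inv l \<otimes> g) \<in> L" using l(1) L(1) by (simp add: subgroup.m_closed)
    then show ?thesis using lG gG by (simp flip: m_assoc)
  qed
  then show ?thesis using L(2) by blast
qed

text \<open>An element of \<open>S j\<close> that carries the facet towards \<open>D k\<close> to
  the facet towards \<open>D k'\<close> carries \<open>D k\<close> to \<open>D k'\<close>, by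
  uniqueness of neighbours. As it lies in \<open>H\<close>, this forces
  \<open>k = k'\<close>.\<close>

lemma adjacent_pairs_orbit_inj:
  assumes H: "subgroup H G" and J: "fundamental H P \<phi> I D J"
    and S: "\<And>j. S j = stabilizer G (setwise \<phi>) (D j) \<inter> H"
  shows "inj_on (\<lambda>(j, j'). (j, orbit (G\<lparr>carrier := S j\<rparr>) (setwise \<phi>) (D j \<inter> D j'))) (adjacent_pairs D J)"
proof -
  interpret group G by (rule group_G)
  have "J \<subseteq> I" using J by (simp add: fundamental_def)
  have "k = k'"
    if adj: "(j, k) \<in> adjacent_pairs D J" "(j, k') \<in> adjacent_pairs D J"
      and eq: "orbit (G\<lparr>carrier := S j\<rparr>) (setwise \<phi>) (D j \<inter> D k) = orbit (G\<lparr>carrier := S j\<rparr>) (setwise \<phi>) (D j \<inter> D k')"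
    for j k k'
  proof -
    have jk: "j \<in> J" "k \<in> J" "k' \<in> J" "adjacent D j k" "adjacent D j k'"
      using adj by (auto simp: adjacent_pairs_def)
    note I = subsetD[OF \<open>J \<subseteq> I\<close> jk(1)] subsetD[OF \<open>J \<subseteq> I\<close> jk(2)] subsetD[OF \<open>J \<subseteq> I\<close> jk(3)]
    have "\<phi> \<one> ` (D j \<inter> D k') = D j \<inter> D k'"
      using act_one[of "D j \<inter> D k'"] chamber_subset[OF I(1)] by auto
    moreover have "\<one> \<in> S j"
      using subgroup_set_stabilizer[OF chamber_subset[OF I(1)]] H by (simp add: S subgroup.one_closed)
    ultimately have "D j \<inter> D k' \<in> orbit (G\<lparr>carrier := S j\<rparr>) (setwise \<phi>) (D j \<inter> D k)"
      unfolding eq by (force simp: orbit_def setwise_def)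
    then obtain g where g: "g \<in> S j" "D j \<inter> D k' = \<phi> g ` (D j \<inter> D k)"
      by (auto simp: orbit_def setwise_def)
    then have "D j \<inter> D k' = D j \<inter> \<phi> g ` D k"
      using act_Int_stabilizer[OF _ I(1) chamber_subset[OF I(2)]] by (simp add: S)
    moreover obtain i where i: "i \<in> I" "\<phi> g ` D k = D i"
      using act_chamber[OF _ I(2), of g] g(1) by (auto simp: S stabilizer_def)
    ultimately have "\<phi> g ` D k = D k'"
      using neighbour_unique[OF jk(5) I(1,3) i(1)] by simp
    then show ?thesis
      using fundamental_eqD[OF J jk(2,3), of g] g(1) by (simp add: S)
  qed
  then show ?thesis by (auto simp: inj_on_def)
qed

text \<open>Minimal generating sets of the groups \<open>S j\<close>, together with one pairing
  element for each facet orbit, generate \<open>H\<close>. The orbits coming from adjacent pairs in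
  \<open>J\<close> contribute the identity and are dropped.\<close>

theorem min_generators_face_pairing_bound:
  assumes int: "connected (interior P)"
    and H: "subgroup H G"
    and J: "fundamental H P \<phi> I D J" "finite J" "J \<noteq> {}"
    and rep: "\<And>i. i \<in> I \<Longrightarrow> \<exists>h\<in>H. \<exists>j\<in>J. \<phi> h ` D j = D i"
    and S: "\<And>j. S j = stabilizer G (setwise \<phi>) (D j) \<inter> H"
  shows "min_generators (G\<lparr>carrier := H\<rparr>) + card (adjacent_pairs D J)
    \<le> (\<Sum>j\<in>J. min_generators (G\<lparr>carrier := S j\<rparr>) + facet_orbit_count G \<phi> (S j) (D j))"
proof -
  interpret group G by (rule group_G)
  have "J \<subseteq> I" using J(1) by (simp add: fundamental_def)
  have DP: "D j \<subseteq> P" if "j \<in> J" for j using that \<open>J \<subseteq> I\<close> chamber_subset by blast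
  have subS: "subgroup (S j) G" if "j \<in> J" for j
    unfolding S using subgroups_Inter_pair[OF subgroup_set_stabilizer[OF DP[OF that]] H] .
  define orb where "orb j = orbit (G\<lparr>carrier := S j\<rparr>) (setwise \<phi>)" for j
  \<comment> \<open>Orbits are tagged with \<open>j\<close>, so that the cardinality is the sum of
    the orbit counts; \<open>N\<close> consists of the orbits whose pairing element can be
    1.\<close>
  define X where "X = (SIGMA j:J. orbits (G\<lparr>carrier := S j\<rparr>) {F. F facet_of D j} (setwise \<phi>))"
  define N where "N = (\<lambda>(j, j'). (j, orb j (D j \<inter> D j'))) ` adjacent_pairs D J"
  have orb_refl: "F \<in> orb j F" if "j \<in> J" "F \<subseteq> P" for j F
    using act_one[OF that(2)] subgroup.one_closed[OF subS[OF that(1)]]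
    unfolding orb_def orbit_def setwise_def by force
  have X_iff: "(j, Q) \<in> X \<longleftrightarrow> j \<in> J \<and> (\<exists>F. F facet_of D j \<and> Q = orb j F)" for j Q
    by (auto simp: X_def orbits_def orb_def)
  have fin_orbits: "finite (orbits (G\<lparr>carrier := S j\<rparr>) {F. F facet_of D j} (setwise \<phi>))" if "j \<in> J" for j
    using finite_facets_polyhedral_cone_in[OF polyhedral_cone_D cone_P, of j] that \<open>J \<subseteq> I\<close>
    by (auto simp: orbits_def)
  then have finX: "finite X"
    using J(2) by (auto simp: X_def)
  have cardX: "card X = (\<Sum>j\<in>J. facet_orbit_count G \<phi> (S j) (D j))"
    unfolding X_def facet_orbit_count_def using J(2) fin_orbits by (simp add: card_SigmaI)
  have "N \<subseteq> X"
    by (auto simp: N_def X_iff adjacent_pairs_def adjacent_def)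
  have cardN: "card N = card (adjacent_pairs D J)"
    unfolding N_def orb_def using adjacent_pairs_orbit_inj[OF H J(1) S] by (rule card_image)
  have "\<exists>h. h \<in> H \<and> (\<exists>j'\<in>J. D j \<inter> \<phi> h ` D j' facet_of D j \<and> Q = orb j (D j \<inter> \<phi> h ` D j'))
      \<and> ((j, Q) \<in> N \<longrightarrow> h = \<one>)" if x: "(j, Q) \<in> X" for j Q
  proof (cases "(j, Q) \<in> N")
    case True
    then obtain j' where "(j, j') \<in> adjacent_pairs D J" "Q = orb j (D j \<inter> D j')"
      by (auto simp: N_def)
    moreover have "\<one> \<in> H" using H by (rule subgroup.one_closed)
    ultimately show ?thesis
      using act_one DP by (intro exI[of _ \<one>]) (auto simp: adjacent_pairs_def adjacent_def intro!: bexI[of _ j'])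
  next
    case False
    obtain F where F: "F facet_of D j" "Q = orb j F" and "j \<in> J" using x X_iff by blast
    then obtain i where i: "i \<in> I" "D j \<inter> D i = F"
      using facet_neighbour[of j F] \<open>J \<subseteq> I\<close> by blast
    then obtain h j' where "h \<in> H" "j' \<in> J" "\<phi> h ` D j' = D i" using rep by blast
    then show ?thesis using F i False by (intro exI[of _ h]) (auto intro!: bexI[of _ j'])
  qed
  then have "\<forall>x\<in>X. \<exists>h. h \<in> H \<and> (\<exists>j'\<in>J. D (fst x) \<inter> \<phi> h ` D j' facet_of D (fst x)
      \<and> snd x = orb (fst x) (D (fst x) \<inter> \<phi> h ` D j')) \<and> (x \<in> N \<longrightarrow> h = \<one>)"
    by auto
  from bchoice[OF this] obtain \<eta> where \<eta>: "\<And>j Q. (j, Q) \<in> X \<Longrightarrow> \<eta> (j, Q) \<in> H \<and>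
      (\<exists>j'\<in>J. D j \<inter> \<phi> (\<eta> (j, Q)) ` D j' facet_of D j \<and> Q = orb j (D j \<inter> \<phi> (\<eta> (j, Q)) ` D j'))
      \<and> ((j, Q) \<in> N \<longrightarrow> \<eta> (j, Q) = \<one>)"
    by fastforce
  have "\<exists>T. finite T \<and> T \<subseteq> S j \<and> card T = min_generators (G\<lparr>carrier := S j\<rparr>) \<and> generate G T = S j"
    if j: "j \<in> J" for j
  proof -
    have "finite (S j)"
      using finite_stabilizer[of j] j \<open>J \<subseteq> I\<close> by (auto simp: S)
    then obtain T where "finite T" "T \<subseteq> S j" "card T = min_generators (G\<lparr>carrier := S j\<rparr>)"
        "generate (G\<lparr>carrier := S j\<rparr>) T = S j"
      using group.min_generators_attained[OF subgroup.subgroup_is_group[OF subS[OF j] is_group]] by auto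
    then show ?thesis using generate_consistent[OF _ subS[OF j]] by auto
  qed
  then have "\<exists>T. \<forall>j\<in>J. finite (T j) \<and> T j \<subseteq> S j \<and> card (T j) = min_generators (G\<lparr>carrier := S j\<rparr>)
      \<and> generate G (T j) = S j"
    by (intro bchoice) blast
  then obtain T where T: "\<And>j. j \<in> J \<Longrightarrow> finite (T j)" "\<And>j. j \<in> J \<Longrightarrow> T j \<subseteq> S j"
      "\<And>j. j \<in> J \<Longrightarrow> card (T j) = min_generators (G\<lparr>carrier := S j\<rparr>)"
      "\<And>j. j \<in> J \<Longrightarrow> generate G (T j) = S j"
    by blast
  define gens where "gens = (\<Union>j\<in>J. T j) \<union> \<eta> ` (X - N)"
  have gensH: "gens \<subseteq> H"
  proof -
    have "T j \<subseteq> H" if "j \<in> J" for j using T(2)[OF that] by (auto simp: S)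
    moreover have "\<eta> x \<in> H" if "x \<in> X" for x using \<eta> that by (cases x) auto
    ultimately show ?thesis by (auto simp: gens_def)
  qed
  then have gensG: "gens \<subseteq> carrier G" using subgroup.subset[OF H] by blast
  define L where "L = generate G gens"
  have L: "subgroup L G"
    unfolding L_def using gensG by (rule generate_is_subgroup)
  have stab: "S j \<subseteq> L" if "j \<in> J" for j
    using mono_generate[of "T j" gens] T(4)[OF that] that by (auto simp: gens_def L_def)
  have \<eta>L: "\<eta> x \<in> L" if "x \<in> X" for x
  proof (cases "x \<in> N")
    case True
    then show ?thesis using \<eta>[of "fst x" "snd x"] that subgroup.one_closed[OF L] by simp
  next
    case False
    then show ?thesis using that by (auto simp: L_def gens_def intro: generate.incl)
  qed
  have "L = H"
  proof (rule subgroup_generated_by_face_pairings[OF int H J(1,3) L])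
    show "L \<subseteq> H"
      unfolding L_def using generate_subgroup_incl[OF gensH H] .
    show "stabilizer G (setwise \<phi>) (D j) \<inter> H \<subseteq> L" if "j \<in> J" for j
      using stab[OF that] by (simp add: S)
    fix j i assume j: "j \<in> J" and i: "i \<in> I" and adj: "adjacent D j i"
    define Q where "Q = orb j (D j \<inter> D i)"
    have jI: "j \<in> I" using j \<open>J \<subseteq> I\<close> by blast
    have x: "(j, Q) \<in> X"
      using adj j by (auto simp: X_iff Q_def adjacent_def)
    define h where "h = \<eta> (j, Q)"
    have h: "h \<in> H" "h \<in> L" using \<eta>[OF x] \<eta>L[OF x] by (auto simp: h_def)
    obtain j' where j': "j' \<in> J" "Q = orb j (D j \<inter> \<phi> h ` D j')"
      using \<eta>[OF x] by (auto simp: h_def)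
    have "D j \<inter> D i \<in> Q"
      unfolding Q_def using orb_refl[OF j] DP[OF j] by blast
    \<comment> \<open>The element \<open>h\<close> was chosen for some facet in the orbit
      \<open>Q\<close>. An element \<open>k\<close> of \<open>S j\<close> moves that facet to the
      given one, so \<open>k \<otimes> h\<close> is the pairing element for
      \<open>D i\<close>.\<close>
    then obtain k where k: "k \<in> S j" "D j \<inter> D i = \<phi> k ` (D j \<inter> \<phi> h ` D j')"
      unfolding j'(2) orb_def by (auto simp: orbit_def setwise_def)
    have G: "k \<in> carrier G" "h \<in> carrier G"
      using k(1) h(1) subS[OF j] H subgroup.subset by blast+
    have "D j \<inter> D i = D j \<inter> \<phi> (k \<otimes> h) ` D j'"
      using k act_Int_stabilizer[OF _ jI act_subset[OF G(2) DP[OF j'(1)]], of k]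
        act_mult[OF G DP[OF j'(1)]] by (simp add: S)
    moreover obtain i' where i': "i' \<in> I" "\<phi> (k \<otimes> h) ` D j' = D i'"
      using act_chamber[OF m_closed[OF G], of j'] j'(1) \<open>J \<subseteq> I\<close> by blast
    ultimately have "\<phi> (k \<otimes> h) ` D j' = D i"
      using neighbour_unique[OF adj jI i i'(1)] by simp
    moreover have "k \<otimes> h \<in> L"
      using k(1) h(2) stab[OF j] L by (meson subgroup.m_closed subsetD)
    ultimately show "\<exists>l\<in>L. \<exists>j'\<in>J. \<phi> l ` D j' = D i" using j'(1) by blast
  qed
  have fin: "finite gens"
    using T(1) J(2) finX by (auto simp: gens_def)
  have "generate (G\<lparr>carrier := H\<rparr>) gens = H"
    using generate_consistent[OF gensH H] \<open>L = H\<close> by (simp add: L_def)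
  then have "min_generators (G\<lparr>carrier := H\<rparr>) \<le> card gens"
    using fin gensH by (intro min_generators_le) auto
  also have "card gens \<le> card (\<Union>j\<in>J. T j) + card (\<eta> ` (X - N))"
    unfolding gens_def by (rule card_Un_le)
  also have "card (\<Union>j\<in>J. T j) \<le> (\<Sum>j\<in>J. card (T j))"
    using J(2) by (rule card_UN_le)
  also have "(\<Sum>j\<in>J. card (T j)) = (\<Sum>j\<in>J. min_generators (G\<lparr>carrier := S j\<rparr>))"
    using T(3) by simp
  also have "card (\<eta> ` (X - N)) \<le> card (X - N)"
    using finX by (intro card_image_le) simp
  also have "card (X - N) = card X - card (adjacent_pairs D J)"
    using card_Diff_subset[OF finite_subset[OF \<open>N \<subseteq> X\<close> finX] \<open>N \<subseteq> X\<close>] cardN by simp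
  finally have "min_generators (G\<lparr>carrier := H\<rparr>)
      \<le> (\<Sum>j\<in>J. min_generators (G\<lparr>carrier := S j\<rparr>)) + (card X - card (adjacent_pairs D J))"
    by simp
  \<comment> \<open>This makes the subtraction of natural numbers above exact.\<close>
  moreover have "card (adjacent_pairs D J) \<le> card X"
    using card_mono[OF finX \<open>N \<subseteq> X\<close>] cardN by simp
  ultimately show ?thesis
    unfolding sum.distrib cardX[symmetric] by linarith
qed

end

theorem theorem3p5:
  fixes G :: "('g, 'b) monoid_scheme"
    and P :: "(real ^ 'n) set"
    and \<phi> :: "'g \<Rightarrow> real ^ 'n \<Rightarrow> real ^ 'n"
    and I :: "'i set" and D :: "'i \<Rightarrow> (real ^ 'n) set"
    and H K :: "'g set" and i\<^sub>0 :: 'i and J :: "'i set"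
    and H_stab :: "'i \<Rightarrow> 'g set" and a :: "'i \<Rightarrow> nat"
  assumes tessellation: "exact_tessellation G P \<phi> I D"
    and interior_connected: "connected (interior P)"
    and fin_gen: "finitely_generated G"
    and subgroup_H: "subgroup H G"
    and finite_index: "finite (rcosets\<^bsub>G\<^esub> H)"
    and i0: "i\<^sub>0 \<in> I"
    and K_def: "K = stabilizer G (setwise \<phi>) (D i\<^sub>0)"
    and fundamental_J: "fundamental H P \<phi> I D J"
    and finite_J: "finite J"
    and card_J: "card J = card (double_cosets G H K)"
    and H_stab_def: "\<And>j. H_stab j = stabilizer G (setwise \<phi>) (D j) \<inter> H"
    and a_def: "\<And>j. a j = facet_orbit_count G \<phi> (H_stab j) (D j)"
  shows "int (min_generators (G\<lparr>carrier := H\<rparr>))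
           \<le> int (\<Sum>j\<in>J. min_generators (G\<lparr>carrier := H_stab j\<rparr>) + a j)
             + int (min_generators (G\<lparr>carrier := K \<inter> H\<rparr>))
             - int (card (adjacent_pairs D J))
         \<and> min_generators (G\<lparr>carrier := H\<rparr>)
           \<le> (\<Sum>j\<in>J. min_generators (G\<lparr>carrier := H_stab j\<rparr>) + a j)
             + min_generators (G\<lparr>carrier := K \<inter> H\<rparr>)"
proof -
  interpret exact_tessellation G P \<phi> I D by (rule tessellation)
  have rep: "\<exists>h\<in>H. \<exists>j\<in>J. \<phi> h ` D j = D i" if "i \<in> I" for i
    by (rule orbit_representatives[OF subgroup_H finite_index i0 fundamental_J _ that])
      (use card_J K_def in auto)
  then have "J \<noteq> {}" using i0 by blast
  then have "min_generators (G\<lparr>carrier := H\<rparr>) + card (adjacent_pairs D J)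
      \<le> (\<Sum>j\<in>J. min_generators (G\<lparr>carrier := H_stab j\<rparr>) + a j)"
    unfolding a_def
    by (rule min_generators_face_pairing_bound
        [OF interior_connected subgroup_H fundamental_J finite_J _ rep H_stab_def])
  then show ?thesis by linarith
qed

end
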